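(* Suppose that $\ker(B)\cap V_0=\{0\}$. Let $\phi$ be a uniformly convex N-function such that $\phi'(t)/t$ is non-decreasing, i.e. $$\frac{\phi'(t)}{t}\le \frac{\phi'(T)}{T}\qquad\text{for all }0<t\le T,$$ and assume the boundedness $$0<c_\phi:=\lim_{t\searrow 0}\frac{\phi'(t)}{t}\le \lim_{T\to\infty}\frac{\phi'(T)}{T}=:C_\phi<\infty .$$ Let $\sigma^0\in\Sigma_f$. Then the dIRLS scheme is well-defined (each weighted least-squares problem has a unique solution $u^{n+1}\in V_0$, and the iterates satisfy $\sigma^n\in\Sigma_f$), and it converges linearly: there is a constant $C_{\mathrm{uc}}\in(0,\infty)$ depending solely on the uniform convexity constants of $\phi$ such that, with $\kappa:=C_{\mathrm{uc}}\,c_\phi/C_\phi$, $$J^*(\sigma^n)-J^*(\sigma)\le (1-\kappa)^n\big(J^*(\sigma^0)-J^*(\sigma)\big)\qquad\text{for all }n\in\mathbb{N}_0,$$ where $\sigma\in\Sigma_f$ is the minimizer of $J^*$ over $\Sigma_f$.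
   Context: N-function: $\phi:[0,\infty)\to[0,\infty)$ is an N-function if it is continuous and convex and there is a right-continuous, non-decreasing $\phi':[0,\infty)\to[0,\infty)$ with $\phi'(0)=0$, $\phi'(t)>0$ for $t>0$, $\lim_{t\to\infty}\phi'(t)=\infty$ and $\phi(t)=\int_0^t\phi'(s)\,ds$. Its Fenchel conjugate is $\phi^*(r):=\sup_{s\ge0}(rs-\phi(s))$, $r\ge 0$; it is again an N-function, with right-continuous derivative $(\phi^* )'(u)=\sup\{r\ge0:\phi'(r)\le u\}$. Uniform convexity: $\phi$ is uniformly convex if there are constants $0<k_1\le k_2<\infty$ (the uniform convexity constants) with $k_1\frac{\phi'(s)}{s}\le\frac{\phi'(t)-\phi'(s)}{t-s}\le k_2\frac{\phi'(s)}{s}$ for all $0\le t<s$. Setting: $M,N\in\mathbb{N}$, $\mathcal{A}=\{1,\dots,M\}$, $B:\mathbb{R}^N\to\mathbb{R}^M$ linear, weights $w_\alpha>0$ ($\alpha\in\mathcal{A}$), $f\in\mathbb{R}^N$, $C\in\mathbb{R}^{m_c\times N}$ and $d\in\mathbb{R}^{m_c}$ with $m_c\in\mathbb{N}_0$, $g\in\mathbb{R}^N$ with $Cg=d$, $V_0:=\ker(C)$. The dual energy and dual space are $$J^*(\tau):=\sum_{\alpha\in\mathcal{A}}w_\alpha\phi^*(w_\alpha^{-1}|\tau_\alpha|)-\tau^\top Bg\quad(\tau\in\mathbb{R}^M),\qquad \Sigma_f:=\{\tau\in\mathbb{R}^M:\tau^\top Bv=f\cdot v\ \text{for all }v\in V_0\}.$$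 dIRLS scheme: given $\sigma^n\in\mathbb{R}^M$, set $a_\alpha:=|\sigma^n_\alpha|/(\phi^* )'(w_\alpha^{-1}|\sigma^n_\alpha|)$, where for $\sigma^n_\alpha=0$ the reciprocal $(\phi^* )'(w_\alpha^{-1}|\sigma_\alpha^n|)/|\sigma_\alpha^n|$ is interpreted as $\lim_{t\searrow0}(\phi^* )'(w_\alpha^{-1}t)/t$. Find $u^{n+1}\in V_0$ with $$\sum_{\alpha\in\mathcal{A}}a_\alpha\,(B(u^{n+1}+g))_\alpha\,(Bv)_\alpha=f\cdot v\qquad\text{for all }v\in V_0,$$ and set $\sigma^{n+1}_\alpha:=a_\alpha\,(B(u^{n+1}+g))_\alpha$ for all $\alpha\in\mathcal{A}$. *)

theory Defs
  imports
    "HOL-Analysis.Henstock_Kurzweil_Integration"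
    "Jordan_Normal_Form.Matrix_Kernel"
begin

text \<open>
  Functions on \<open>[0,\<infinity>)\<close> are represented by functions on \<open>real\<close>; only their values at
  nonnegative arguments matter. The second argument is the right-continuous derivative of the
  N-function; it is determined by the first one on \<open>[0,\<infinity>)\<close>.
\<close>

definition N_function :: "(real \<Rightarrow> real) \<Rightarrow> (real \<Rightarrow> real) \<Rightarrow> bool" where
  "N_function \<phi> \<phi>' \<longleftrightarrow>
     (\<forall>t\<ge>0. 0 \<le> \<phi> t) \<and> continuous_on {0..} \<phi> \<and> convex_on {0..} \<phi> \<and>
     (\<forall>t\<ge>0. 0 \<le> \<phi>' t) \<and> (\<forall>t\<ge>0. continuous (at_right t) \<phi>') \<and> mono_on {0..} \<phi>' \<and>
     \<phi>' 0 = 0 \<and> (\<forall>t>0. 0 < \<phi>' t) \<and> filterlim \<phi>' at_top at_top \<and>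
     (\<forall>t\<ge>0. (\<phi>' has_integral \<phi> t) {0..t})"

text \<open>
  For an N-function and \<open>r, u \<ge> 0\<close> the sets below are nonempty and bounded above, so that the
  suprema are genuine.
\<close>

definition fenchel_conjugate :: "(real \<Rightarrow> real) \<Rightarrow> real \<Rightarrow> real" where
  "fenchel_conjugate \<phi> r = (SUP s\<in>{0..}. r * s - \<phi> s)"

definition conjugate_deriv :: "(real \<Rightarrow> real) \<Rightarrow> real \<Rightarrow> real" where
  "conjugate_deriv \<phi>' u = Sup {r. 0 \<le> r \<and> \<phi>' r \<le> u}"

definition uniformly_convex_with :: "real \<Rightarrow> real \<Rightarrow> (real \<Rightarrow> real) \<Rightarrow> bool" where
  "uniformly_convex_with k1 k2 \<phi>' \<longleftrightarrow>
     0 < k1 \<and> k1 \<le> k2 \<and>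
     (\<forall>t s. 0 \<le> t \<and> t < s \<longrightarrow>
        k1 * (\<phi>' s / s) \<le> (\<phi>' s - \<phi>' t) / (s - t) \<and>
        (\<phi>' s - \<phi>' t) / (s - t) \<le> k2 * (\<phi>' s / s))"

text \<open>
  The linear map \<open>B\<close> is given by its matrix, and the indices \<open>1, \<dots>, M\<close> become \<open>0, \<dots>, M - 1\<close>.
\<close>

definition dual_energy :: "(real \<Rightarrow> real) \<Rightarrow> real vec \<Rightarrow> real mat \<Rightarrow> real vec \<Rightarrow> real vec \<Rightarrow> real" where
  "dual_energy \<phi> w B g \<tau> =
     (\<Sum>\<alpha><dim_vec \<tau>. w $ \<alpha> * fenchel_conjugate \<phi> (inverse (w $ \<alpha>) * \<bar>\<tau> $ \<alpha>\<bar>)) - \<tau> \<bullet> (B *\<^sub>v g)"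

definition dual_space :: "real mat \<Rightarrow> real mat \<Rightarrow> real vec \<Rightarrow> real vec set" where
  "dual_space B C f =
     {\<tau> \<in> carrier_vec (dim_row B). \<forall>v\<in>mat_kernel C. \<tau> \<bullet> (B *\<^sub>v v) = f \<bullet> v}"

definition dual_minimizer ::
    "(real \<Rightarrow> real) \<Rightarrow> real vec \<Rightarrow> real mat \<Rightarrow> real mat \<Rightarrow> real vec \<Rightarrow> real vec \<Rightarrow> real vec \<Rightarrow> bool" where
  "dual_minimizer \<phi> w B C f g \<sigma> \<longleftrightarrow>
     \<sigma> \<in> dual_space B C f \<and>
     (\<forall>\<tau>\<in>dual_space B C f. dual_energy \<phi> w B g \<sigma> \<le> dual_energy \<phi> w B g \<tau>)"

text \<open>
  The coefficient \<open>a\<^sub>\<alpha>\<close> for the weight \<open>\<omega> = w\<^sub>\<alpha>\<close> and the value \<open>s = \<sigma>\<^sup>n\<^sub>\<alpha>\<close>. Since \<open>Lim\<close> and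
  division are total, \<open>dirls_coeff_defined\<close> records that the expression is meaningful: the
  limit exists and no reciprocal of zero is taken.
\<close>

definition dirls_coeff :: "(real \<Rightarrow> real) \<Rightarrow> real \<Rightarrow> real \<Rightarrow> real" where
  "dirls_coeff \<phi>' \<omega> s =
     (if s = 0 then inverse (Lim (at_right 0) (\<lambda>t. conjugate_deriv \<phi>' (inverse \<omega> * t) / t))
      else \<bar>s\<bar> / conjugate_deriv \<phi>' (inverse \<omega> * \<bar>s\<bar>))"

definition dirls_coeff_defined :: "(real \<Rightarrow> real) \<Rightarrow> real \<Rightarrow> real \<Rightarrow> bool" where
  "dirls_coeff_defined \<phi>' \<omega> s \<longleftrightarrow>
     (if s = 0
      then \<exists>L. L \<noteq> 0 \<and> ((\<lambda>t. conjugate_deriv \<phi>' (inverse \<omega> * t) / t) \<longlongrightarrow> L) (at_right 0)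
      else conjugate_deriv \<phi>' (inverse \<omega> * \<bar>s\<bar>) \<noteq> 0)"

definition dirls_solution ::
    "(real \<Rightarrow> real) \<Rightarrow> real vec \<Rightarrow> real mat \<Rightarrow> real mat \<Rightarrow> real vec \<Rightarrow> real vec \<Rightarrow> real vec \<Rightarrow> real vec \<Rightarrow> bool" where
  "dirls_solution \<phi>' w B C f g \<sigma> u \<longleftrightarrow>
     u \<in> mat_kernel C \<and>
     (\<forall>v\<in>mat_kernel C.
        (\<Sum>\<alpha><dim_row B. dirls_coeff \<phi>' (w $ \<alpha>) (\<sigma> $ \<alpha>) * (B *\<^sub>v (u + g)) $ \<alpha> * (B *\<^sub>v v) $ \<alpha>) = f \<bullet> v)"

definition dirls_step ::
    "(real \<Rightarrow> real) \<Rightarrow> real vec \<Rightarrow> real mat \<Rightarrow> real mat \<Rightarrow> real vec \<Rightarrow> real vec \<Rightarrow> real vec \<Rightarrow> real vec" where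
  "dirls_step \<phi>' w B C f g \<sigma> =
     (let u = (THE u. dirls_solution \<phi>' w B C f g \<sigma> u)
      in vec (dim_row B) (\<lambda>\<alpha>. dirls_coeff \<phi>' (w $ \<alpha>) (\<sigma> $ \<alpha>) * (B *\<^sub>v (u + g)) $ \<alpha>))"

definition dirls ::
    "(real \<Rightarrow> real) \<Rightarrow> real vec \<Rightarrow> real mat \<Rightarrow> real mat \<Rightarrow> real vec \<Rightarrow> real vec \<Rightarrow> real vec \<Rightarrow> nat \<Rightarrow> real vec" where
  "dirls \<phi>' w B C f g \<sigma>0 n = (dirls_step \<phi>' w B C f g ^^ n) \<sigma>0"

end

theory Submission
  imports Defs "HOL-Analysis.Lipschitz" "Jordan_Normal_Form.DL_Rank"
begin

text \<open>
  Write \<open>\<psi> = \<phi>\<^sup>*\<close>. Because \<open>\<phi>'(t)/t\<close> is non-decreasing, \<open>\<psi>'(u)/u\<close> is non-increasing, so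
  \<open>\<psi>\<close> is a concave function of \<open>u\<^sup>2\<close> and lies below the quadratic \<open>\<psi>(s) + \<psi>'(s)/(2s) (t\<^sup>2 - s\<^sup>2)\<close>.
  Summed over the components this is a quadratic majorant of \<open>J\<^sup>*\<close> touching it at \<open>\<sigma>\<^sup>n\<close>, and
  the weighted least-squares solution \<open>\<sigma>\<^bsup>n+1\<^esup>\<close> is exactly its minimizer over \<open>\<Sigma>\<^sub>f\<close>. On the other
  hand \<open>\<phi>'\<close> is Lipschitz with constant \<open>L = k\<^sub>2 C\<^sub>\<phi>\<close>, so \<open>J\<^sup>*\<close> is strongly convex, with a modulus
  at least \<open>c\<^sub>\<phi>/L\<close> times the curvature of the majorant. Evaluating the majorant at
  \<open>\<sigma>\<^sup>n + (c\<^sub>\<phi>/L) (\<sigma> - \<sigma>\<^sup>n)\<close> gives the decay factor \<open>1 - c\<^sub>\<phi>/L\<close> per step, that is \<open>C\<^sub>u\<^sub>c = 1/k\<^sub>2\<close>.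
\<close>

no_notation inner (infix "\<bullet>" 70)
no_notation vec_nth (infixl "$" 90)

section \<open>Weighted least squares on a kernel\<close>

text \<open>The columns of \<open>K\<close> form a finite basis of the kernel: spanning gives the
  image, independence the injectivity. Equations tested on the kernel thereby become square linear
  systems in coordinates.\<close>

lemma mat_kernel_parametrization:
  fixes A :: "'a :: field mat"
  assumes A: "A \<in> carrier_mat nr nc"
  obtains k K where "K \<in> carrier_mat nc k"
    and "mat_kernel A = {K *\<^sub>v x | x. x \<in> carrier_vec k}"
    and "\<forall>x\<in>carrier_vec k. K *\<^sub>v x = 0\<^sub>v nc \<longrightarrow> x = 0\<^sub>v k"
proof -
  interpret kernel nr nc A by unfold_locales (rule A)
  obtain b where fin: "finite b" and basis: "basis b"
    using kernel_basis_exists[OF A] by blast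
  from basis have sub: "b \<subseteq> mat_kernel A" and span: "span b = mat_kernel A"
    and indep: "\<not> lin_dep b"
    unfolding Ker.basis_def by auto
  have bc: "b \<subseteq> carrier_vec nc" using sub mat_kernel_carrier[OF A] by auto
  obtain bs where bs: "set bs = b" "distinct bs" using finite_distinct_list[OF fin] by blast
  define K where "K = mat_of_cols nc bs"
  have K: "K \<in> carrier_mat nc (length bs)" by (simp add: K_def)
  have cols: "cols K = bs" using bs bc by (simp add: K_def)
  have in_kernel: "A *\<^sub>v (K *\<^sub>v x) = 0\<^sub>v nr" if x: "x \<in> carrier_vec (length bs)" for x
  proof -
    have "A * K = 0\<^sub>m nr (length bs)"
    proof (rule eq_matI)
      fix i j assume ij: "i < dim_row (0\<^sub>m nr (length bs))" "j < dim_col (0\<^sub>m nr (length bs))"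
      hence "bs ! j \<in> mat_kernel A" using sub bs by auto
      hence "A *\<^sub>v (bs ! j) = 0\<^sub>v nr" "bs ! j \<in> carrier_vec nc" using mat_kernelD[OF A] by auto
      moreover have "col K j = bs ! j" using ij calculation by (simp add: K_def)
      ultimately show "(A * K) $$ (i, j) = 0\<^sub>m nr (length bs) $$ (i, j)"
        using ij A K by (metis carrier_matD index_mult_mat(1) index_mult_mat_vec index_zero_mat
            index_zero_vec(1))
    qed (use A K in auto)
    hence "(A * K) *\<^sub>v x = 0\<^sub>v nr" using x by (intro eq_vecI) auto
    thus ?thesis using A K x by (simp add: assoc_mult_mat_vec)
  qed
  have "mat_kernel A \<subseteq> {K *\<^sub>v x | x. x \<in> carrier_vec (length bs)}"
  proof
    fix v assume "v \<in> mat_kernel A"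
    \<comment> \<open>\<open>basis\<close> refers to the kernel as a vector space of its own, while
      \<open>NC\<close> is the full space; \<open>span_same\<close>, and below
      \<open>lindep_same\<close>, move between the two.\<close>
    hence "v \<in> NC.span b" using span span_same[OF sub] by simp
    then obtain a where "v = NC.lincomb a b"
      using NC.finite_in_span[OF fin] bc by auto
    hence "v = K *\<^sub>v vec (length bs) (\<lambda>i. a (col K i))"
      using NC.mat_mult_eq_lincomb[OF K, of a] cols bs by simp
    thus "v \<in> {K *\<^sub>v x | x. x \<in> carrier_vec (length bs)}"
      by (auto intro!: exI[of _ "vec (length bs) (\<lambda>i. a (col K i))"])
  qed
  moreover have "{K *\<^sub>v x | x. x \<in> carrier_vec (length bs)} \<subseteq> mat_kernel A"
    using in_kernel A K by (auto intro!: mat_kernelI[OF A])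
  moreover have "\<forall>x\<in>carrier_vec (length bs). K *\<^sub>v x = 0\<^sub>v nc \<longrightarrow> x = 0\<^sub>v (length bs)"
  proof (intro ballI impI, rule ccontr)
    fix x assume x: "x \<in> carrier_vec (length bs)" "K *\<^sub>v x = 0\<^sub>v nc"
    assume "x \<noteq> 0\<^sub>v (length bs)"
    from NC.lin_depI[OF K x(1) this x(2)] have "NC.lin_dep b" using cols bs by metis
    thus False using indep lindep_same[OF sub] by metis
  qed
  ultimately show thesis by (intro that[OF K] subset_antisym)
qed

lemma nonsingular_solve:
  fixes G :: "'a :: field mat"
  assumes G: "G \<in> carrier_mat k k"
    and inj: "\<And>x. x \<in> carrier_vec k \<Longrightarrow> G *\<^sub>v x = 0\<^sub>v k \<Longrightarrow> x = 0\<^sub>v k"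
    and r: "r \<in> carrier_vec k"
  obtains y where "y \<in> carrier_vec k" "G *\<^sub>v y = r"
proof -
  have "det G \<noteq> 0" using det_0_iff_vec_prod_zero_field[OF G] inj by blast
  from det_non_zero_imp_unit[OF G this] obtain H where H: "H \<in> carrier_mat k k" "G * H = 1\<^sub>m k"
    unfolding Units_def by (auto simp: ring_mat_def)
  have "G *\<^sub>v (H *\<^sub>v r) = r"
    using G H r by (metis assoc_mult_mat_vec one_mult_mat_vec)
  thus thesis using that[of "H *\<^sub>v r"] H r by auto
qed

lemma scalar_prod_mat_vec:
  fixes A :: "'a :: comm_semiring_0 mat"
  assumes "A \<in> carrier_mat n k" "x \<in> carrier_vec k" "y \<in> carrier_vec n"
  shows "y \<bullet> (A *\<^sub>v x) = (transpose_mat A *\<^sub>v y) \<bullet> x"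
  using transpose_vec_mult_scalar[OF assms] by simp

text \<open>Positive weights force \<open>B *\<^sub>v v\<close> to vanish, so \<open>v\<close> lies
  in both kernels. This definiteness serves twice: for invertibility of the Gram matrix and for
  uniqueness of the least-squares solution.\<close>

lemma weighted_square_sum_zero:
  fixes B :: "real mat"
  assumes B: "B \<in> carrier_mat M N" and C: "C \<in> carrier_mat m N"
    and ker: "mat_kernel B \<inter> mat_kernel C = {0\<^sub>v N}"
    and pos: "\<And>\<alpha>. \<alpha> < M \<Longrightarrow> 0 < a \<alpha>"
    and v: "v \<in> mat_kernel C"
    and zero: "(\<Sum>\<alpha><M. a \<alpha> * ((B *\<^sub>v v) $ \<alpha>)\<^sup>2) = 0"
  shows "v = 0\<^sub>v N"
proof -
  have "a \<alpha> * ((B *\<^sub>v v) $ \<alpha>)\<^sup>2 = 0" if "\<alpha> < M" for \<alpha>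
    using zero pos that by (subst (asm) sum_nonneg_eq_0_iff) (auto simp: less_imp_le)
  hence "(B *\<^sub>v v) $ \<alpha> = 0" if "\<alpha> < M" for \<alpha> using pos[OF that] that by fastforce
  hence "B *\<^sub>v v = 0\<^sub>v M" using B by (intro eq_vecI) auto
  hence "v \<in> mat_kernel B" using B C v mat_kernelD[OF C v] by (intro mat_kernelI[OF B])
  thus ?thesis using ker v by blast
qed

text \<open>In kernel coordinates the condition is a normal equation
  \<open>G *\<^sub>v y = r\<close>. Its square matrix is injective by definiteness, which yields
  existence.\<close>

lemma weighted_least_squares_unique_solution:
  fixes B C :: "real mat"
  assumes B: "B \<in> carrier_mat M N" and C: "C \<in> carrier_mat m N"
    and f: "f \<in> carrier_vec N" and g: "g \<in> carrier_vec N"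
    and ker: "mat_kernel B \<inter> mat_kernel C = {0\<^sub>v N}"
    and pos: "\<And>\<alpha>. \<alpha> < M \<Longrightarrow> 0 < a \<alpha>"
  shows "\<exists>!u. u \<in> mat_kernel C \<and>
    (\<forall>v\<in>mat_kernel C. (\<Sum>\<alpha><M. a \<alpha> * (B *\<^sub>v (u + g)) $ \<alpha> * (B *\<^sub>v v) $ \<alpha>) = f \<bullet> v)"
proof -
  obtain k K where K: "K \<in> carrier_mat N k"
    and image: "mat_kernel C = {K *\<^sub>v x | x. x \<in> carrier_vec k}"
    and inj: "\<forall>x\<in>carrier_vec k. K *\<^sub>v x = 0\<^sub>v N \<longrightarrow> x = 0\<^sub>v k"
    by (rule mat_kernel_parametrization[OF C])
  define W where "W y = vec M (\<lambda>\<alpha>. a \<alpha> * y $ \<alpha>)" for y :: "real vec"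
  define E where "E = B * K"
  \<comment> \<open>With D the diagonal matrix of the weights, \<open>G\<close> is E^T D E. The
    right-hand side \<open>r\<close> is \<open>f\<close> pulled back to coordinates, minus the
    contribution of the fixed shift \<open>g\<close>.\<close>
  define G where "G = transpose_mat E * mat M k (\<lambda>(\<alpha>, j). a \<alpha> * E $$ (\<alpha>, j))"
  define r where "r = transpose_mat K *\<^sub>v f - transpose_mat E *\<^sub>v W (B *\<^sub>v g)"
  have W: "W y \<in> carrier_vec M" for y by (simp add: W_def)
  have E: "E \<in> carrier_mat M k" using B K by (simp add: E_def)
  have G: "G \<in> carrier_mat k k" using E by (simp add: G_def)
  have r: "r \<in> carrier_vec k" using K E W f by (auto simp: r_def)
  have EK: "E *\<^sub>v x = B *\<^sub>v (K *\<^sub>v x)" if "x \<in> carrier_vec k" for x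
    using B K that by (simp add: E_def assoc_mult_mat_vec)
  have Gx: "G *\<^sub>v x = transpose_mat E *\<^sub>v W (E *\<^sub>v x)" if x: "x \<in> carrier_vec k" for x
  proof -
    have "mat M k (\<lambda>(\<alpha>, j). a \<alpha> * E $$ (\<alpha>, j)) *\<^sub>v x = W (E *\<^sub>v x)"
      using E x by (intro eq_vecI) (auto simp: W_def scalar_prod_def sum_distrib_left mult.assoc)
    thus ?thesis using E x by (simp add: G_def assoc_mult_mat_vec[of _ k M _ k])
  qed
  have form: "(\<Sum>\<alpha><M. a \<alpha> * y $ \<alpha> * (B *\<^sub>v (K *\<^sub>v z)) $ \<alpha>) = (transpose_mat E *\<^sub>v W y) \<bullet> z"
    if "z \<in> carrier_vec k" for y z
  proof -
    have "(transpose_mat E *\<^sub>v W y) \<bullet> z = W y \<bullet> (E *\<^sub>v z)"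
      using scalar_prod_mat_vec[OF E that W] by simp
    also have "\<dots> = (\<Sum>\<alpha><M. a \<alpha> * y $ \<alpha> * (B *\<^sub>v (K *\<^sub>v z)) $ \<alpha>)"
      using E that B K by (auto simp: scalar_prod_def W_def EK atLeast0LessThan intro!: sum.cong)
    finally show ?thesis by simp
  qed
  have "x = 0\<^sub>v k" if x: "x \<in> carrier_vec k" and 0: "G *\<^sub>v x = 0\<^sub>v k" for x
  proof -
    have "(\<Sum>\<alpha><M. a \<alpha> * ((B *\<^sub>v (K *\<^sub>v x)) $ \<alpha>)\<^sup>2) = (G *\<^sub>v x) \<bullet> x"
      using form[OF x, of "E *\<^sub>v x"] Gx[OF x] EK[OF x] by (simp add: power2_eq_square mult.assoc)
    hence "(\<Sum>\<alpha><M. a \<alpha> * ((B *\<^sub>v (K *\<^sub>v x)) $ \<alpha>)\<^sup>2) = 0" using 0 x by simp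
    hence "K *\<^sub>v x = 0\<^sub>v N"
      using weighted_square_sum_zero[where a = a, OF B C ker pos] x image by blast
    thus ?thesis using inj x by blast
  qed
  then obtain y where y: "y \<in> carrier_vec k" "G *\<^sub>v y = r"
    using nonsingular_solve[OF G _ r] by blast
  have sol: "(\<Sum>\<alpha><M. a \<alpha> * (B *\<^sub>v (K *\<^sub>v y + g)) $ \<alpha> * (B *\<^sub>v v) $ \<alpha>) = f \<bullet> v"
    if v: "v \<in> mat_kernel C" for v
  proof -
    obtain z where z: "z \<in> carrier_vec k" "v = K *\<^sub>v z" using v image by blast
    have "W (B *\<^sub>v (K *\<^sub>v y + g)) = W (E *\<^sub>v y) + W (B *\<^sub>v g)"
      using B K g y E by (intro eq_vecI) 
        (auto simp: W_def EK mult_add_distrib_mat_vec[OF B] algebra_simps)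
    hence "transpose_mat E *\<^sub>v W (B *\<^sub>v (K *\<^sub>v y + g)) = r + transpose_mat E *\<^sub>v W (B *\<^sub>v g)"
      using E W y Gx[OF y(1)] by (simp add: mult_add_distrib_mat_vec[of _ k M])
    also have "\<dots> = transpose_mat K *\<^sub>v f"
      using K E W f by (intro eq_vecI) (auto simp: r_def)
    finally show ?thesis
      using form[OF z(1), of "B *\<^sub>v (K *\<^sub>v y + g)"] scalar_prod_mat_vec[OF K z(1) f] z by simp
  qed
  have mem: "K *\<^sub>v y \<in> mat_kernel C" using y image by blast
  \<comment> \<open>Testing with the difference of two solutions cancels \<open>g\<close> and leaves
    its weighted square sum.\<close>
  have uniq: "u = u'" if u: "u \<in> mat_kernel C" and u': "u' \<in> mat_kernel C"
    and eq: "\<And>v. v \<in> mat_kernel C \<Longrightarrow>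
      (\<Sum>\<alpha><M. a \<alpha> * (B *\<^sub>v (u + g)) $ \<alpha> * (B *\<^sub>v v) $ \<alpha>) =
      (\<Sum>\<alpha><M. a \<alpha> * (B *\<^sub>v (u' + g)) $ \<alpha> * (B *\<^sub>v v) $ \<alpha>)" for u u'
  proof -
    have c: "u \<in> carrier_vec N" "u' \<in> carrier_vec N" using u u' mat_kernelD[OF C] by auto
    have v: "u - u' \<in> mat_kernel C"
      using c u u' C mat_kernelD(2)[OF C]
      by (intro mat_kernelI[OF C]) (auto simp: mult_minus_distrib_mat_vec[OF C])
    have "(\<Sum>\<alpha><M. a \<alpha> * ((B *\<^sub>v (u - u')) $ \<alpha>)\<^sup>2) =
        (\<Sum>\<alpha><M. a \<alpha> * (B *\<^sub>v (u + g)) $ \<alpha> * (B *\<^sub>v (u - u')) $ \<alpha>) -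
        (\<Sum>\<alpha><M. a \<alpha> * (B *\<^sub>v (u' + g)) $ \<alpha> * (B *\<^sub>v (u - u')) $ \<alpha>)"
      using B c g by (auto simp: sum_subtractf[symmetric] mult_minus_distrib_mat_vec[OF B]
          mult_add_distrib_mat_vec[OF B] power2_eq_square algebra_simps intro!: sum.cong)
    hence "u - u' = 0\<^sub>v N"
      using weighted_square_sum_zero[where a = a, OF B C ker pos v] eq[OF v] by simp
    hence "(u - u') $ i = 0" if "i < N" for i using that by simp
    thus ?thesis using c by (intro eq_vecI) auto
  qed
  show ?thesis
  proof (rule ex1I[of _ "K *\<^sub>v y"])
    fix u
    assume "u \<in> mat_kernel C \<and>
      (\<forall>v\<in>mat_kernel C. (\<Sum>\<alpha><M. a \<alpha> * (B *\<^sub>v (u + g)) $ \<alpha> * (B *\<^sub>v v) $ \<alpha>) = f \<bullet> v)"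
    thus "u = K *\<^sub>v y" using sol mem by (intro uniq) auto
  qed (use sol mem in auto)
qed

section \<open>Strongly convex minimization\<close>

text \<open>
  \<open>G x\<close> plays the role of the gradient of \<open>F\<close>, of which no continuity is needed: the convexity
  inequality makes minimizing sequences Cauchy and \<open>F\<close> lower semicontinuous.
\<close>

lemma strongly_convex_unique_minimizer:
  fixes F :: "real vec \<Rightarrow> real" and G :: "real vec \<Rightarrow> nat \<Rightarrow> real"
  assumes S: "S \<subseteq> carrier_vec M" "S \<noteq> {}" and m: "0 < m"
    and midpoint: "\<And>x y. x \<in> S \<Longrightarrow> y \<in> S \<Longrightarrow> (1 / 2) \<cdot>\<^sub>v (x + y) \<in> S"
    and closed: "\<And>X x. (\<And>n. X n \<in> S) \<Longrightarrow> x \<in> carrier_vec M \<Longrightarrow>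
      (\<And>i. i < M \<Longrightarrow> (\<lambda>n. X n $ i) \<longlonglongrightarrow> x $ i) \<Longrightarrow> x \<in> S"
    and convex: "\<And>x y. x \<in> S \<Longrightarrow> y \<in> S \<Longrightarrow>
      F x + (\<Sum>i<M. G x i * (y $ i - x $ i)) + m * (\<Sum>i<M. (y $ i - x $ i)\<^sup>2) \<le> F y"
  shows "\<exists>!x. x \<in> S \<and> (\<forall>y\<in>S. F x \<le> F y)"
proof -
  obtain x0 where x0: "x0 \<in> S" using S by blast
  have bdd: "bdd_below (F ` S)"
  proof (rule bdd_belowI2)
    fix y assume y: "y \<in> S"
    \<comment> \<open>Completing the square in each component: a linear term plus a positive
      quadratic is bounded below.\<close>
    have "- (\<Sum>i<M. (G x0 i)\<^sup>2 / (4 * m)) \<le>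
        (\<Sum>i<M. G x0 i * (y $ i - x0 $ i)) + m * (\<Sum>i<M. (y $ i - x0 $ i)\<^sup>2)"
    proof -
      have "- (g\<^sup>2 / (4 * m)) \<le> g * d + m * d\<^sup>2" for g d :: real
      proof -
        have "g * d + m * d\<^sup>2 + g\<^sup>2 / (4 * m) = (g + 2 * m * d)\<^sup>2 / (4 * m)"
          using m by (simp add: field_simps power2_eq_square)
        moreover have "0 \<le> (g + 2 * m * d)\<^sup>2 / (4 * m)" using m by simp
        ultimately show ?thesis by linarith
      qed
      thus ?thesis
        unfolding sum_negf[symmetric] sum_distrib_left sum.distrib[symmetric] by (intro sum_mono)
    qed
    thus "F x0 - (\<Sum>i<M. (G x0 i)\<^sup>2 / (4 * m)) \<le> F y" using convex[OF x0 y] by linarith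
  qed
  define I where "I = (INF x\<in>S. F x)"
  have I_le: "I \<le> F y" if "y \<in> S" for y
    unfolding I_def by (rule cINF_lower[OF bdd that])
  \<comment> \<open>Adding the convexity inequalities from the midpoint \<open>z\<close> to
    \<open>x\<close> and to \<open>y\<close> cancels the linear terms. Each squared distance is a
    quarter of the full one, whence the factor \<open>m / 2\<close>.\<close>
  have mid: "m / 2 * (\<Sum>i<M. (x $ i - y $ i)\<^sup>2) \<le> (F x - I) + (F y - I)"
    if x: "x \<in> S" and y: "y \<in> S" for x y
  proof -
    define z where "z = (1 / 2) \<cdot>\<^sub>v (x + y)"
    have z: "z \<in> S" using midpoint x y by (simp add: z_def)
    have c: "x \<in> carrier_vec M" "y \<in> carrier_vec M" using x y S by auto
    have zi: "z $ i = (x $ i + y $ i) / 2" if "i < M" for i using c that by (simp add: z_def)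
    have eqs: "(\<Sum>i<M. G z i * (x $ i - z $ i)) = - (\<Sum>i<M. G z i * (y $ i - z $ i))"
      "(\<Sum>i<M. (x $ i - z $ i)\<^sup>2) = (\<Sum>i<M. (x $ i - y $ i)\<^sup>2) / 4"
      "(\<Sum>i<M. (y $ i - z $ i)\<^sup>2) = (\<Sum>i<M. (x $ i - y $ i)\<^sup>2) / 4"
      unfolding sum_divide_distrib sum_negf[symmetric]
      by (auto simp: zi field_simps power2_eq_square intro!: sum.cong)
    show ?thesis
      using convex[OF z x] convex[OF z y] I_le[OF z] unfolding eqs by (simp add: field_simps)
  qed
  have dist: "(x $ i - y $ i)\<^sup>2 \<le> 2 / m * ((F x - I) + (F y - I))"
    if "x \<in> S" "y \<in> S" "i < M" for x y i
  proof -
    have "(x $ i - y $ i)\<^sup>2 \<le> (\<Sum>i<M. (x $ i - y $ i)\<^sup>2)"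
      using that by (intro member_le_sum) auto
    also have "\<dots> \<le> 2 / m * ((F x - I) + (F y - I))"
      using mid[OF that(1,2)] m by (simp add: field_simps)
    finally show ?thesis .
  qed
  have "\<exists>x. x \<in> S \<and> F x < I + 1 / real (Suc n)" for n
  proof -
    have "Inf (F ` S) < I + 1 / real (Suc n)" by (simp add: I_def)
    thus ?thesis using S by (subst (asm) cInf_less_iff[OF _ bdd]) auto
  qed
  then obtain X where X: "\<And>n. X n \<in> S" and FX: "\<And>n. F (X n) < I + 1 / real (Suc n)"
    by metis
  have lim0: "(\<lambda>n. c * (1 / real (Suc n))) \<longlonglongrightarrow> 0" for c :: real
    by (intro tendsto_mult_right_zero LIMSEQ_Suc lim_1_over_n)
  have conv: "convergent (\<lambda>n. X n $ i)" if i: "i < M" for i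
  proof -
    have "Cauchy (\<lambda>n. X n $ i)"
    proof (rule metric_CauchyI)
      fix e :: real assume e: "0 < e"
      hence "0 < e\<^sup>2" by simp
      from order_tendstoD(2)[OF lim0[of "4 / m"] this]
      obtain n0 where n0: "\<And>n. n \<ge> n0 \<Longrightarrow> 4 / m * (1 / real (Suc n)) < e\<^sup>2"
        unfolding eventually_sequentially by blast
      have "dist (X p $ i) (X q $ i) < e" if pq: "n0 \<le> p" "n0 \<le> q" for p q
      proof -
        have "1 / real (Suc p) \<le> 1 / real (Suc n0)" "1 / real (Suc q) \<le> 1 / real (Suc n0)"
          using pq by (auto intro!: divide_left_mono)
        hence "(F (X p) - I) + (F (X q) - I) \<le> 2 * (1 / real (Suc n0))"
          using FX[of p] FX[of q] by linarith
        hence "2 / m * ((F (X p) - I) + (F (X q) - I)) \<le> 2 / m * (2 * (1 / real (Suc n0)))"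
          using m by (intro mult_left_mono) auto
        also have "\<dots> < e\<^sup>2" using n0[of n0] by simp
        finally have "(X p $ i - X q $ i)\<^sup>2 < e\<^sup>2" using dist[OF X X i, of p q] by linarith
        thus ?thesis
          using e power2_less_imp_less[of "\<bar>X p $ i - X q $ i\<bar>" e] by (simp add: dist_real_def)
      qed
      thus "\<exists>n0. \<forall>p\<ge>n0. \<forall>q\<ge>n0. dist (X p $ i) (X q $ i) < e" by blast
    qed
    thus ?thesis by (simp add: Cauchy_convergent_iff)
  qed
  define x where "x = vec M (\<lambda>i. lim (\<lambda>n. X n $ i))"
  have lim: "(\<lambda>n. X n $ i) \<longlonglongrightarrow> x $ i" if "i < M" for i
    using conv[OF that] that by (simp add: x_def convergent_LIMSEQ_iff)
  have x: "x \<in> S" by (rule closed[OF X _ lim]) (simp_all add: x_def)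
  have "F x \<le> I"
  proof (rule tendsto_le[OF sequentially_bot])
    show "(\<lambda>n. I + 1 * (1 / real (Suc n))) \<longlonglongrightarrow> I" using tendsto_add[OF tendsto_const lim0] by simp
    have "(\<lambda>n. F x + (\<Sum>i<M. G x i * (X n $ i - x $ i))) \<longlonglongrightarrow> F x + (\<Sum>i<M. G x i * (x $ i - x $ i))"
      by (intro tendsto_intros lim) auto
    thus "(\<lambda>n. F x + (\<Sum>i<M. G x i * (X n $ i - x $ i))) \<longlonglongrightarrow> F x" by simp
    have "F x + (\<Sum>i<M. G x i * (X n $ i - x $ i)) \<le> I + 1 * (1 / real (Suc n))" for n
    proof -
      have "0 \<le> m * (\<Sum>i<M. (X n $ i - x $ i)\<^sup>2)" using m by (intro mult_nonneg_nonneg sum_nonneg) auto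
      thus ?thesis using convex[OF x X[of n]] FX[of n] by linarith
    qed
    thus "\<forall>\<^sub>F n in sequentially. F x + (\<Sum>i<M. G x i * (X n $ i - x $ i)) \<le> I + 1 * (1 / real (Suc n))"
      by simp
  qed
  hence min: "\<forall>y\<in>S. F x \<le> F y" using I_le by force
  show ?thesis
  proof (rule ex1I[of _ x])
    fix y assume y: "y \<in> S \<and> (\<forall>z\<in>S. F y \<le> F z)"
    hence "F y \<le> I" using \<open>F x \<le> I\<close> x by force
    hence "2 / m * ((F y - I) + (F x - I)) \<le> 0"
      using \<open>F x \<le> I\<close> m by (intro mult_nonneg_nonpos) auto
    hence "(y $ i - x $ i)\<^sup>2 \<le> 0" if "i < M" for i using dist[OF _ x that, of y] y by linarith
    moreover have "y \<in> carrier_vec M" "x \<in> carrier_vec M" using y x S by auto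
    ultimately show "y = x" by (intro eq_vecI) auto
  qed (use x min in blast)
qed

section \<open>The conjugate of a uniformly convex N-function\<close>

locale bounded_uniformly_convex_N_function =
  fixes \<phi> \<phi>' :: "real \<Rightarrow> real" and k1 k2 c C :: real
  assumes N_function: "N_function \<phi> \<phi>'"
    and uniformly_convex: "uniformly_convex_with k1 k2 \<phi>'"
    and ratio_mono: "\<And>t T. 0 < t \<Longrightarrow> t \<le> T \<Longrightarrow> \<phi>' t / t \<le> \<phi>' T / T"
    and ratio_at_0: "((\<lambda>t. \<phi>' t / t) \<longlongrightarrow> c) (at_right 0)"
    and ratio_at_top: "((\<lambda>t. \<phi>' t / t) \<longlongrightarrow> C) at_top"
    and c_pos: "0 < c"
begin

section \<open>Growth, Lipschitz continuity and bijectivity of the derivative\<close>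

definition L where "L = k2 * C"

lemma deriv_nonneg: "0 \<le> t \<Longrightarrow> 0 \<le> \<phi>' t"
  and deriv_pos: "0 < t \<Longrightarrow> 0 < \<phi>' t"
  and deriv_0 [simp]: "\<phi>' 0 = 0"
  and deriv_mono: "0 \<le> s \<Longrightarrow> s \<le> t \<Longrightarrow> \<phi>' s \<le> \<phi>' t"
  and has_integral_deriv: "0 \<le> t \<Longrightarrow> (\<phi>' has_integral \<phi> t) {0..t}"
  using N_function by (auto simp: N_function_def mono_on_def)

lemma uniform_convexity:
  assumes "0 \<le> t" "t < s"
  shows "k1 * (\<phi>' s / s) \<le> (\<phi>' s - \<phi>' t) / (s - t)"
    and "(\<phi>' s - \<phi>' t) / (s - t) \<le> k2 * (\<phi>' s / s)"
  using assms uniformly_convex by (auto simp: uniformly_convex_with_def)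

lemma k1_pos: "0 < k1"
  using uniformly_convex by (auto simp: uniformly_convex_with_def)

text \<open>At \<open>t = 0\<close> the difference quotient is the ratio
  \<open>\<phi>' s / s\<close> itself, and this is positive.\<close>

lemma k2_ge_1: "1 \<le> k2"
  using uniform_convexity(2)[of 0 1] deriv_pos[of 1] by simp

text \<open>A monotone ratio stays between its limits at 0 and at infinity; this lemma and the next
  are the two halves.\<close>

lemma ratio_ge: "0 < t \<Longrightarrow> c \<le> \<phi>' t / t"
  by (rule tendsto_upperbound[OF ratio_at_0])
    (auto simp: eventually_at_right_field intro!: exI[of _ t] ratio_mono)

lemma ratio_le: "0 < t \<Longrightarrow> \<phi>' t / t \<le> C"
  by (rule tendsto_lowerbound[OF ratio_at_top])
    (auto simp: eventually_at_top_linorder intro!: exI[of _ t] ratio_mono)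

lemma C_pos: "0 < C"
  using ratio_ge[of 1] ratio_le[of 1] c_pos by simp

lemma L_pos: "0 < L"
  using C_pos k2_ge_1 by (simp add: L_def)

lemma C_le_L: "C \<le> L"
  using C_pos k2_ge_1 by (simp add: L_def)

lemma deriv_ge: "0 \<le> t \<Longrightarrow> c * t \<le> \<phi>' t"
  using ratio_ge[of t] by (cases "t = 0") (auto simp: field_simps)

lemma deriv_le: "0 \<le> t \<Longrightarrow> \<phi>' t \<le> C * t"
  using ratio_le[of t] by (cases "t = 0") (auto simp: field_simps)

text \<open>Uniform convexity bounds the difference quotient by \<open>k2\<close> times the ratio at
  the right endpoint, and the ratio never exceeds \<open>C\<close>.\<close>

lemma deriv_lipschitz:
  assumes "0 \<le> t" "t \<le> s"
  shows "\<phi>' s - \<phi>' t \<le> L * (s - t)"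
proof (cases "t = s")
  case False
  hence ts: "t < s" "0 < s" using assms by auto
  have "(\<phi>' s - \<phi>' t) / (s - t) \<le> k2 * (\<phi>' s / s)" by (rule uniform_convexity(2)[OF assms(1) ts(1)])
  also have "\<dots> \<le> L"
    unfolding L_def using ratio_le[OF ts(2)] k2_ge_1 by (intro mult_left_mono) auto
  finally show ?thesis using ts by (simp add: field_simps)
qed simp

lemma deriv_strict_mono:
  assumes "0 \<le> t" "t < s"
  shows "\<phi>' t < \<phi>' s"
proof -
  have "0 < k1 * (\<phi>' s / s)" using assms k1_pos deriv_pos[of s] by auto
  hence "0 < (\<phi>' s - \<phi>' t) / (s - t)" using uniform_convexity(1)[OF assms] by linarith
  thus ?thesis using assms by (simp add: zero_less_divide_iff)
qed

text \<open>Intermediate value theorem on \<open>{0..u / c}\<close>, where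
  \<open>c * t \<le> \<phi>' t\<close> guarantees that the value \<open>u\<close> is reached.
  Together with strict monotonicity this makes \<open>conjugate_deriv\<close> a true inverse of
  \<open>\<phi>'\<close>.\<close>

lemma deriv_surj:
  assumes "0 \<le> u"
  obtains r where "0 \<le> r" "\<phi>' r = u"
proof -
  have "continuous_on {0..} \<phi>'"
  proof (rule lipschitz_on_continuous_on)
    show "L-lipschitz_on {0..} \<phi>'"
    proof (rule lipschitz_onI)
      fix x y :: real assume xy: "x \<in> {0..}" "y \<in> {0..}"
      show "dist (\<phi>' x) (\<phi>' y) \<le> L * dist x y"
        using deriv_lipschitz[of x y] deriv_lipschitz[of y x] deriv_mono[of x y] deriv_mono[of y x] xy
        by (cases "x \<le> y") (auto simp: dist_real_def)
    qed (use L_pos in simp)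
  qed
  hence "continuous_on {0..u / c} \<phi>'" by (rule continuous_on_subset) auto
  moreover have "u \<le> \<phi>' (u / c)" using deriv_ge[of "u / c"] c_pos assms by simp
  ultimately obtain r where "0 \<le> r" "\<phi>' r = u"
    using IVT'[of \<phi>' 0 u "u / c"] assms c_pos by auto
  thus thesis using that by blast
qed

section \<open>Quadratic bounds on the N-function\<close>

lemma has_integral_deriv_interval:
  assumes "0 \<le> a" "a \<le> b"
  shows "(\<phi>' has_integral \<phi> b - \<phi> a) {a..b}"
proof -
  have int: "\<phi>' integrable_on {0..b}" using has_integral_deriv[of b] assms by auto
  hence "\<phi>' integrable_on {a..b}" by (rule integrable_on_subinterval) (use assms in auto)
  moreover have "integral {a..b} \<phi>' = \<phi> b - \<phi> a"
    using Henstock_Kurzweil_Integration.integral_combine[OF assms int]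
      has_integral_deriv[of a] has_integral_deriv[of b] assms by (auto simp: integral_unique)
  ultimately show ?thesis by (metis has_integral_integral)
qed

text \<open>Integrated comparison: linear bounds on \<open>\<phi>'\<close> become quadratic bounds
  on \<open>\<phi>\<close>. All estimates of \<open>\<phi>\<close> below come from this lemma and
  its mirror image \<open>increment_ge\<close>.\<close>

lemma increment_le:
  assumes "0 \<le> a" "a \<le> b" "\<And>x. a \<le> x \<Longrightarrow> x \<le> b \<Longrightarrow> \<phi>' x \<le> q x"
    and Q: "\<And>x. (Q has_real_derivative q x) (at x)"
  shows "\<phi> b - \<phi> a \<le> Q b - Q a"
proof (rule has_integral_le[OF has_integral_deriv_interval])
  show "(q has_integral Q b - Q a) {a..b}"
    using Q assms(2) by (intro fundamental_theorem_of_calculus)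
      (auto simp: has_real_derivative_iff_has_vector_derivative[symmetric] intro: DERIV_subset)
qed (use assms in auto)

lemma increment_ge:
  assumes "0 \<le> a" "a \<le> b" "\<And>x. a \<le> x \<Longrightarrow> x \<le> b \<Longrightarrow> q x \<le> \<phi>' x"
    and Q: "\<And>x. (Q has_real_derivative q x) (at x)"
  shows "Q b - Q a \<le> \<phi> b - \<phi> a"
proof (rule has_integral_le[OF _ has_integral_deriv_interval])
  show "(q has_integral Q b - Q a) {a..b}"
    using Q assms(2) by (intro fundamental_theorem_of_calculus)
      (auto simp: has_real_derivative_iff_has_vector_derivative[symmetric] intro: DERIV_subset)
qed (use assms in auto)

lemma phi_0 [simp]: "\<phi> 0 = 0"
  using has_integral_deriv[of 0] by (simp add: has_integral_refl has_integral_unique)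

text \<open>This is convexity of \<open>\<phi>\<close> in the squared variable. By monotonicity of
  the ratio, \<open>\<phi>'\<close> lies below the line through the origin of slope
  \<open>\<phi>' r / r\<close> before \<open>r\<close> and above it afterwards; integrating from
  \<open>r\<close> to \<open>p\<close> in either direction gives the claim.\<close>

lemma phi_ge_quadratic:
  assumes r: "0 < r" and p: "0 \<le> p"
  shows "\<phi> r + \<phi>' r / (2 * r) * (p\<^sup>2 - r\<^sup>2) \<le> \<phi> p"
proof -
  define Q where "Q x = \<phi>' r / (2 * r) * x\<^sup>2" for x
  have Q: "(Q has_real_derivative \<phi>' r / r * x) (at x)" for x
    unfolding Q_def by (auto intro!: derivative_eq_intros simp: field_simps r[THEN less_imp_neq, symmetric])
  have le: "\<phi>' x \<le> \<phi>' r / r * x" if "0 \<le> x" "x \<le> r" for x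
    using ratio_mono[of x r] that r by (cases "x = 0") (auto simp: field_simps)
  have ge: "\<phi>' r / r * x \<le> \<phi>' x" if "r \<le> x" for x
    using ratio_mono[of r x] that r by (auto simp: field_simps)
  have "Q p - Q r \<le> \<phi> p - \<phi> r"
  proof (cases "r \<le> p")
    case True
    show ?thesis by (rule increment_ge[OF _ True _ Q]) (use r ge in auto)
  next
    case False
    have "\<phi> r - \<phi> p \<le> Q r - Q p" by (rule increment_le[OF p _ _ Q]) (use p False le in auto)
    thus ?thesis by simp
  qed
  thus ?thesis by (simp add: Q_def algebra_simps)
qed

lemma phi_ge_square:
  assumes "0 \<le> p"
  shows "c / 2 * p\<^sup>2 \<le> \<phi> p"
proof -
  have "((\<lambda>x. c / 2 * x\<^sup>2) has_real_derivative c * x) (at x)" for x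
    by (auto intro!: derivative_eq_intros)
  from increment_ge[OF _ assms _ this] show ?thesis using deriv_ge by simp
qed

text \<open>For positive \<open>r\<close> the lower bound of \<open>phi_ge_quadratic\<close> exceeds
  the tangent by a nonnegative multiple of the square of \<open>p - r\<close>. The case
  \<open>r = 0\<close> only needs that \<open>\<phi>\<close> is nonnegative.\<close>

lemma phi_ge_tangent:
  assumes r: "0 \<le> r" and p: "0 \<le> p"
  shows "\<phi> r + \<phi>' r * (p - r) \<le> \<phi> p"
proof (cases "r = 0")
  case True
  have "0 \<le> c / 2 * p\<^sup>2" using c_pos by simp
  thus ?thesis using phi_ge_square[OF p] True by simp
next
  case False
  have "\<phi>' r / (2 * r) * (p\<^sup>2 - r\<^sup>2) - \<phi>' r * (p - r) = \<phi>' r / (2 * r) * (p - r)\<^sup>2"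
    using False by (simp add: field_simps power2_eq_square)
  moreover have "0 \<le> \<phi>' r / (2 * r) * (p - r)\<^sup>2" using r deriv_nonneg[OF r] by simp
  ultimately show ?thesis using phi_ge_quadratic[of r p] r p False by linarith
qed

text \<open>The descent lemma: the Lipschitz bound on \<open>\<phi>'\<close>, integrated between
  \<open>r\<close> and \<open>p\<close>.\<close>

lemma phi_le_quadratic:
  assumes r: "0 \<le> r" and p: "0 \<le> p"
  shows "\<phi> p \<le> \<phi> r + \<phi>' r * (p - r) + L / 2 * (p - r)\<^sup>2"
proof -
  define Q where "Q x = \<phi>' r * (x - r) + L / 2 * (x - r)\<^sup>2" for x
  have Q: "(Q has_real_derivative \<phi>' r + L * (x - r)) (at x)" for x
    unfolding Q_def by (auto intro!: derivative_eq_intros)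
  have "\<phi> p - \<phi> r \<le> Q p - Q r"
  proof (cases "r \<le> p")
    case True
    show ?thesis
      by (rule increment_le[OF r True _ Q]) (use r deriv_lipschitz[of r] in \<open>auto simp: algebra_simps\<close>)
  next
    case False
    have "Q r - Q p \<le> \<phi> r - \<phi> p"
      by (rule increment_ge[OF p _ _ Q])
        (use p False deriv_lipschitz[of _ r] in \<open>auto simp: algebra_simps\<close>)
    thus ?thesis by simp
  qed
  thus ?thesis by (simp add: Q_def)
qed

section \<open>The conjugate and its quadratic bounds\<close>

abbreviation \<psi> where "\<psi> \<equiv> fenchel_conjugate \<phi>"
abbreviation \<psi>' where "\<psi>' \<equiv> conjugate_deriv \<phi>'"

text \<open>By strict monotonicity the set in the supremum is exactly \<open>{0..r}\<close>.\<close>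

lemma conjugate_deriv_deriv:
  assumes "0 \<le> r"
  shows "\<psi>' (\<phi>' r) = r"
proof -
  have "\<phi>' x \<le> \<phi>' r \<longleftrightarrow> x \<le> r" if "0 \<le> x" for x
    using deriv_mono[OF that, of r] deriv_strict_mono[OF assms, of x] by linarith
  hence "{x. 0 \<le> x \<and> \<phi>' x \<le> \<phi>' r} = {0..r}" by auto
  thus ?thesis using assms by (simp add: conjugate_deriv_def)
qed

lemma conjugate_deriv_pos:
  assumes "0 < u"
  shows "0 < \<psi>' u"
proof -
  obtain r where r: "0 \<le> r" "\<phi>' r = u" using deriv_surj[of u] assms by auto
  with assms have "r \<noteq> 0" by auto
  with r show ?thesis using conjugate_deriv_deriv[OF r(1)] by simp
qed

lemma deriv_conjugate_deriv:
  assumes "0 \<le> u"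
  shows "0 \<le> \<psi>' u" "\<phi>' (\<psi>' u) = u"
  using deriv_surj[OF assms] conjugate_deriv_deriv by metis+

text \<open>The tangent to \<open>\<phi>\<close> at \<open>\<psi>' u\<close> has slope
  \<open>u\<close>, so the tangent inequality says that the supremum is attained there.\<close>

lemma conjugate_eq:
  assumes "0 \<le> u"
  shows "\<psi> u = u * \<psi>' u - \<phi> (\<psi>' u)"
  unfolding fenchel_conjugate_def
proof (rule cSup_eq_maximum)
  note r = deriv_conjugate_deriv[OF assms]
  show "u * \<psi>' u - \<phi> (\<psi>' u) \<in> (\<lambda>s. u * s - \<phi> s) ` {0..}" using r by auto
  show "x \<le> u * \<psi>' u - \<phi> (\<psi>' u)" if "x \<in> (\<lambda>s. u * s - \<phi> s) ` {0..}" for x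
    using that phi_ge_tangent[OF r(1)] r by (auto simp: algebra_simps)
qed

lemma fenchel_young:
  assumes "0 \<le> u" "0 \<le> p"
  shows "u * p - \<phi> p \<le> \<psi> u"
  using conjugate_eq[OF assms(1)] deriv_conjugate_deriv[OF assms(1)] phi_ge_tangent[of "\<psi>' u" p] assms
  by (simp add: algebra_simps)

lemma conjugate_0 [simp]: "\<psi> 0 = 0"
  using conjugate_eq[of 0] conjugate_deriv_deriv[of 0] by simp

text \<open>The majorant at the base point 0, where the ratio \<open>\<psi>' s / s\<close> has to be
  replaced by its limit \<open>inverse c\<close>.\<close>

lemma conjugate_le_square:
  assumes t: "0 \<le> t"
  shows "\<psi> t \<le> t\<^sup>2 / (2 * c)"
proof -
  have "t * \<psi>' t - c / 2 * (\<psi>' t)\<^sup>2 = t\<^sup>2 / (2 * c) - (t - c * \<psi>' t)\<^sup>2 / (2 * c)"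
    using c_pos by (simp add: field_simps power2_eq_square)
  moreover have "0 \<le> (t - c * \<psi>' t)\<^sup>2 / (2 * c)" using c_pos by simp
  ultimately show ?thesis
    using conjugate_eq[OF t] phi_ge_square[of "\<psi>' t"] deriv_conjugate_deriv[OF t] by linarith
qed

text \<open>Dual form of \<open>phi_ge_quadratic\<close>: that bound is inserted for
  \<open>\<phi> p\<close> at the maximizer \<open>p\<close> belonging to \<open>t\<close>, and what
  remains is a perfect square.\<close>

lemma conjugate_le_quadratic:
  assumes s: "0 < s" and t: "0 \<le> t"
  shows "\<psi> t \<le> \<psi> s + \<psi>' s / (2 * s) * (t\<^sup>2 - s\<^sup>2)"
proof -
  define r p where "r = \<psi>' s" and "p = \<psi>' t"
  have r: "0 < r" "\<phi>' r = s" and p: "0 \<le> p" "\<phi>' p = t"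
    using deriv_conjugate_deriv[of s] deriv_conjugate_deriv[of t] conjugate_deriv_pos[of s] s t
    by (auto simp: r_def p_def)
  have "r * s + r / (2 * s) * (t\<^sup>2 - s\<^sup>2) - (t * p - s / (2 * r) * (p\<^sup>2 - r\<^sup>2)) =
      (s * p - r * t)\<^sup>2 / (2 * r * s)"
    using r s by (simp add: field_simps power2_eq_square)
  moreover have "0 \<le> (s * p - r * t)\<^sup>2 / (2 * r * s)" using r s by simp
  moreover have "\<phi> r + s / (2 * r) * (p\<^sup>2 - r\<^sup>2) \<le> \<phi> p"
    using phi_ge_quadratic[OF r(1) p(1)] r by simp
  moreover have "\<psi> s = r * s - \<phi> r" "\<psi> t = t * p - \<phi> p"
    using conjugate_eq[of s] conjugate_eq[of t] s t by (simp_all add: r_def p_def mult.commute)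
  ultimately show ?thesis unfolding r_def[symmetric] by linarith
qed

text \<open>Stated with \<open>L\<close> rather than the smaller \<open>C\<close> because it is
  paired with the modulus \<open>1 / L\<close>: it keeps the trial point of
  \<open>conjugate_ge_quadratic\<close> nonnegative and handles sign changes in
  \<open>energy_density_ge\<close>.\<close>

lemma conjugate_deriv_ge:
  assumes "0 \<le> s"
  shows "s / L \<le> \<psi>' s"
proof -
  note r = deriv_conjugate_deriv[OF assms]
  have "s \<le> C * \<psi>' s" using deriv_le[OF r(1)] r by simp
  also have "\<dots> \<le> L * \<psi>' s" using C_le_L r by (intro mult_right_mono)
  finally show ?thesis using L_pos by (simp add: field_simps)
qed

lemma conjugate_deriv_le:
  assumes "0 \<le> s"
  shows "\<psi>' s \<le> s / c"
  using deriv_ge[of "\<psi>' s"] deriv_conjugate_deriv[OF assms] c_pos by (simp add: field_simps)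

text \<open>Smoothness of \<open>\<phi>\<close> dualizes to strong convexity of
  \<open>\<psi>\<close>: a trial point is put into the Fenchel-Young inequality and
  \<open>\<phi>\<close> is bounded above there by \<open>phi_le_quadratic\<close>.\<close>

lemma conjugate_ge_quadratic:
  assumes s: "0 \<le> s" and t: "0 \<le> t"
  shows "\<psi> s + \<psi>' s * (t - s) + (t - s)\<^sup>2 / (2 * L) \<le> \<psi> t"
proof -
  define r where "r = \<psi>' s"
  \<comment> \<open>\<open>p\<close> maximizes \<open>t p\<close> minus the quadratic upper bound of \<open>\<phi>\<close> at \<open>r\<close>.\<close>
  define p where "p = r + (t - s) / L"
  have r: "0 \<le> r" "\<phi>' r = s" using deriv_conjugate_deriv[OF s] by (auto simp: r_def)
  have p: "0 \<le> p"
    using conjugate_deriv_ge[OF s] divide_nonneg_pos[OF t L_pos]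
    by (simp add: p_def r_def diff_divide_distrib)
  have "t * p - (s * (p - r) + L / 2 * (p - r)\<^sup>2) = s * r + r * (t - s) + (t - s)\<^sup>2 / (2 * L)"
    using L_pos by (simp add: p_def field_simps power2_eq_square)
  thus ?thesis
    using fenchel_young[OF t p] phi_le_quadratic[OF r(1) p] conjugate_eq[OF s] r
    by (simp add: r_def[symmetric])
qed

text \<open>With \<open>r = \<psi>' u\<close> the quotient is the inverse of
  \<open>\<phi>' r / r\<close>, and \<open>r\<close> tends to 0 from the right because it is
  positive and at most \<open>u / c\<close>.\<close>

lemma conjugate_deriv_ratio_at_0: "((\<lambda>u. \<psi>' u / u) \<longlongrightarrow> inverse c) (at_right 0)"
proof -
  have "((\<lambda>u. u / c) \<longlongrightarrow> 0 / c) (at_right 0)"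
    by (intro tendsto_intros) (use c_pos in auto)
  hence "(\<psi>' \<longlongrightarrow> 0) (at_right 0)"
    by (intro tendsto_sandwich[of "\<lambda>_. 0" \<psi>' "at_right 0" "\<lambda>u. u / c"])
      (auto simp: eventually_at_right_less eventually_at_right_field less_imp_le
        intro!: conjugate_deriv_le deriv_conjugate_deriv exI[of _ 1])
  hence "filterlim \<psi>' (at_right 0) (at_right 0)"
    by (auto simp: filterlim_at eventually_at_right_field intro!: exI[of _ 1] dest: conjugate_deriv_pos)
  from tendsto_inverse[OF filterlim_compose[OF ratio_at_0 this]]
  have "((\<lambda>u. inverse (\<phi>' (\<psi>' u) / \<psi>' u)) \<longlongrightarrow> inverse c) (at_right 0)" using c_pos by simp
  thus ?thesis
    by (rule Lim_transform_eventually)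
      (auto simp: eventually_at_right_field deriv_conjugate_deriv intro!: exI[of _ 1])
qed

section \<open>The IRLS coefficients and the energy of a single component\<close>

lemma coefficient_limit:
  assumes w: "0 < w"
  shows "((\<lambda>t. \<psi>' (inverse w * t) / t) \<longlongrightarrow> inverse (c * w)) (at_right 0)"
proof -
  have "((\<lambda>t. inverse w * t) \<longlongrightarrow> inverse w * 0) (at_right 0)" by (intro tendsto_intros)
  hence "filterlim (\<lambda>t. inverse w * t) (at_right 0) (at_right 0)"
    using w by (auto simp: filterlim_at eventually_at_right_field intro!: exI[of _ 1])
  from tendsto_mult_left[OF filterlim_compose[OF conjugate_deriv_ratio_at_0 this], of "inverse w"]
  show ?thesis using w by (simp add: field_simps)
qed

lemma coeff_0: "0 < w \<Longrightarrow> dirls_coeff \<phi>' w 0 = c * w"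
  using tendsto_Lim[OF _ coefficient_limit] by (simp add: dirls_coeff_def)

lemma coeff_defined: "0 < w \<Longrightarrow> dirls_coeff_defined \<phi>' w x"
  using coefficient_limit[of w] c_pos conjugate_deriv_pos[of "inverse w * \<bar>x\<bar>"]
  by (auto simp: dirls_coeff_defined_def intro!: exI[of _ "inverse (c * w)"])

text \<open>This bounds the curvature \<open>1 / a\<close> of the majorant by
  \<open>1 / (c * w)\<close>; equality at \<open>x = 0\<close> comes from the limit
  convention.\<close>

lemma coeff_ge:
  assumes w: "0 < w"
  shows "c * w \<le> dirls_coeff \<phi>' w x"
proof (cases "x = 0")
  case False
  define s where "s = inverse w * \<bar>x\<bar>"
  have s: "0 < s" using False w by (simp add: s_def)
  have "c * w * \<psi>' s \<le> \<bar>x\<bar>"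
    using conjugate_deriv_le[of s] s w c_pos by (simp add: s_def field_simps)
  hence "c * w \<le> \<bar>x\<bar> / \<psi>' s" using conjugate_deriv_pos[OF s] by (simp add: pos_le_divide_eq)
  moreover have "dirls_coeff \<phi>' w x = \<bar>x\<bar> / \<psi>' s"
    using False by (simp add: dirls_coeff_def s_def)
  ultimately show ?thesis by simp
qed (use assms coeff_0 in simp)

lemma coeff_pos: "0 < w \<Longrightarrow> 0 < dirls_coeff \<phi>' w x"
  using coeff_ge[of w x] c_pos by (smt (verit) mult_pos_pos)

text \<open>The one-component majorant. The coefficient is chosen so that \<open>1 / a\<close> is
  the slope of the conjugate at \<open>\<bar>x\<bar> / w\<close>, divided by
  \<open>\<bar>x\<bar>\<close>; the base point \<open>x = 0\<close> uses
  \<open>conjugate_le_square\<close>.\<close>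

lemma energy_density_le:
  assumes w: "0 < w"
  shows "w * \<psi> (inverse w * \<bar>y\<bar>) \<le>
    w * \<psi> (inverse w * \<bar>x\<bar>) + (y\<^sup>2 - x\<^sup>2) / (2 * dirls_coeff \<phi>' w x)"
proof (cases "x = 0")
  case True
  have "w * \<psi> (inverse w * \<bar>y\<bar>) \<le> w * ((inverse w * \<bar>y\<bar>)\<^sup>2 / (2 * c))"
    using w conjugate_le_square by (intro mult_left_mono) auto
  also have "\<dots> = y\<^sup>2 / (2 * (c * w))"
    using w c_pos by (simp add: field_simps power2_eq_square)
  finally show ?thesis using True w by (simp add: coeff_0)
next
  case False
  define s where "s = inverse w * \<bar>x\<bar>"
  have s: "0 < s" using False w by (simp add: s_def)
  have "w * \<psi> (inverse w * \<bar>y\<bar>) \<le>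
      w * (\<psi> s + \<psi>' s / (2 * s) * ((inverse w * \<bar>y\<bar>)\<^sup>2 - s\<^sup>2))"
    using w s conjugate_le_quadratic by (intro mult_left_mono) auto
  also have "\<dots> = w * \<psi> s + \<psi>' s / (2 * \<bar>x\<bar>) * (y\<^sup>2 - x\<^sup>2)"
    using w False by (simp add: s_def field_simps power2_eq_square)
  finally show ?thesis using False by (simp add: dirls_coeff_def s_def mult.commute)
qed

text \<open>Strong convexity is carried from the half-line to the even extension on the whole line.
  The slope of that extension at \<open>x\<close> is
  \<open>x / dirls_coeff \<phi>' w x\<close>.\<close>

lemma energy_density_ge:
  assumes w: "0 < w"
  shows "w * \<psi> (inverse w * \<bar>x\<bar>) + x / dirls_coeff \<phi>' w x * (y - x) + (y - x)\<^sup>2 / (2 * L * w) \<le>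
    w * \<psi> (inverse w * \<bar>y\<bar>)"
proof -
  define s t where "s = inverse w * \<bar>x\<bar>" and "t = inverse w * \<bar>y\<bar>"
  have st: "0 \<le> s" "0 \<le> t" using w by (auto simp: s_def t_def)
  have ws: "w * s = \<bar>x\<bar>" and wt: "w * t = \<bar>y\<bar>"
    using w by (simp_all add: s_def t_def mult.assoc[symmetric])
  have grad: "x / dirls_coeff \<phi>' w x = sgn x * \<psi>' s"
  proof (cases "x = 0")
    case False
    have "x / dirls_coeff \<phi>' w x = x / \<bar>x\<bar> * \<psi>' s" using False by (simp add: dirls_coeff_def s_def)
    thus ?thesis by (simp add: real_sgn_eq)
  qed simp
  \<comment> \<open>For \<open>y\<close> of opposite sign, \<open>\<psi>' s \<ge> s / L\<close> makes \<open>y\<close> no worse than \<open>\<bar>y\<bar>\<close>.\<close>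
  have "sgn x * \<psi>' s * (y - x) + (y - x)\<^sup>2 / (2 * L * w) \<le> w * (\<psi>' s * (t - s) + (t - s)\<^sup>2 / (2 * L))"
  proof -
    have xx: "sgn x * x = w * s" "x\<^sup>2 = (w * s)\<^sup>2" "y\<^sup>2 = (w * t)\<^sup>2" 
      unfolding ws wt by (auto simp: sgn_if)
    \<comment> \<open>For nonzero \<open>x\<close>, \<open>z\<close> is \<open>y\<close> measured in
      the direction of \<open>x\<close>. The gap \<open>w * t - z\<close> is then zero if the signs
      agree and twice \<open>\<bar>y\<bar>\<close> if they are opposite.\<close>
    define z where "z = sgn x * y"
    have z: "z \<le> w * t" unfolding wt by (auto simp: z_def sgn_if)
    have xy: "x * y = w * s * z" unfolding ws by (auto simp: z_def sgn_if)
    have "w * (\<psi>' s * (t - s) + (t - s)\<^sup>2 / (2 * L)) - (sgn x * \<psi>' s * (y - x) + (y - x)\<^sup>2 / (2 * L * w))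
        = \<psi>' s * (w * t - z) - (2 * w\<^sup>2 * t * s - 2 * (x * y)) / (2 * L * w)"
    proof -
      have e1: "(y - x)\<^sup>2 = (w * t)\<^sup>2 + (w * s)\<^sup>2 - 2 * (x * y)"
        unfolding power2_diff xx by simp
      have e2: "sgn x * \<psi>' s * (y - x) = \<psi>' s * (z - w * s)"
        unfolding xx(1)[symmetric] z_def by (simp add: algebra_simps)
      show ?thesis
        unfolding e1 e2 using L_pos w by (simp add: field_simps power2_eq_square)
    qed
    also have "\<dots> = (\<psi>' s - s / L) * (w * t - z)"
      unfolding xy using L_pos w by (simp add: field_simps power2_eq_square)
    also have "\<dots> \<ge> 0"
      using conjugate_deriv_ge[OF st(1)] z by (intro mult_nonneg_nonneg) auto
    finally show ?thesis by linarith
  qed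
  moreover have "w * (\<psi> s + \<psi>' s * (t - s) + (t - s)\<^sup>2 / (2 * L)) \<le> w * \<psi> t"
    using conjugate_ge_quadratic[OF st] w by (intro mult_left_mono) auto
  ultimately show ?thesis
    unfolding grad s_def[symmetric] t_def[symmetric] by (simp add: algebra_simps)
qed

end

section \<open>The dual iteration\<close>

text \<open>The constraint matrix is called \<open>A\<close> here, since \<open>C\<close> already
  denotes the limit of the ratio at infinity.\<close>

locale dual_problem = bounded_uniformly_convex_N_function \<phi> \<phi>' k1 k2 c C
  for \<phi> \<phi>' :: "real \<Rightarrow> real" and k1 k2 c C :: real +
  fixes M N m :: nat and B A :: "real mat" and w f g :: "real vec"
  assumes B: "B \<in> carrier_mat M N" and A: "A \<in> carrier_mat m N"
    and w_pos: "\<And>\<alpha>. \<alpha> < M \<Longrightarrow> 0 < w $ \<alpha>"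
    and f: "f \<in> carrier_vec N" and g: "g \<in> carrier_vec N"
    and ker: "mat_kernel B \<inter> mat_kernel A = {0\<^sub>v N}"
begin

abbreviation "J \<equiv> dual_energy \<phi> w B g"
abbreviation "\<Sigma> \<equiv> dual_space B A f"
abbreviation "step \<equiv> dirls_step \<phi>' w B A f g"
abbreviation "irls_weight \<sigma> \<alpha> \<equiv> dirls_coeff \<phi>' (w $ \<alpha>) (\<sigma> $ \<alpha>)"

section \<open>The dual energy and the affine dual space\<close>

lemma energy_eq:
  assumes "\<tau> \<in> carrier_vec M"
  shows "J \<tau> = (\<Sum>\<alpha><M. w $ \<alpha> * \<psi> (inverse (w $ \<alpha>) * \<bar>\<tau> $ \<alpha>\<bar>) - \<tau> $ \<alpha> * (B *\<^sub>v g) $ \<alpha>)"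
  using assms B unfolding dual_energy_def sum_subtractf
  by (auto simp: scalar_prod_def atLeast0LessThan)

lemma dual_space_iff:
  "\<tau> \<in> \<Sigma> \<longleftrightarrow> \<tau> \<in> carrier_vec M \<and>
    (\<forall>v\<in>mat_kernel A. (\<Sum>\<alpha><M. \<tau> $ \<alpha> * (B *\<^sub>v v) $ \<alpha>) = f \<bullet> v)"
proof -
  have "\<tau> \<bullet> (B *\<^sub>v v) = (\<Sum>\<alpha><M. \<tau> $ \<alpha> * (B *\<^sub>v v) $ \<alpha>)" for v
    using B by (auto simp: scalar_prod_def atLeast0LessThan)
  thus ?thesis using B by (auto simp: dual_space_def)
qed

lemma dual_space_carrier: "\<Sigma> \<subseteq> carrier_vec M"
  by (auto simp: dual_space_iff)

text \<open>Used with \<open>\<mu> = 1 / 2\<close> for midpoints and with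
  \<open>\<mu> = c / L\<close> for the competitor in \<open>energy_decay\<close>.\<close>

lemma dual_space_affine:
  assumes \<sigma>: "\<sigma> \<in> \<Sigma>" and \<tau>: "\<tau> \<in> \<Sigma>" and \<rho>: "\<rho> \<in> carrier_vec M"
    and comb: "\<And>\<alpha>. \<alpha> < M \<Longrightarrow> \<rho> $ \<alpha> = \<sigma> $ \<alpha> + \<mu> * (\<tau> $ \<alpha> - \<sigma> $ \<alpha>)"
  shows "\<rho> \<in> \<Sigma>"
  unfolding dual_space_iff
proof (intro conjI ballI)
  fix v assume v: "v \<in> mat_kernel A"
  let ?s = "\<lambda>x. \<Sum>\<alpha><M. x $ \<alpha> * (B *\<^sub>v v) $ \<alpha>"
  have "?s \<rho> = ?s \<sigma> + \<mu> * (?s \<tau> - ?s \<sigma>)"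
    unfolding sum_subtractf[symmetric] sum_distrib_left sum.distrib[symmetric]
    by (intro sum.cong) (auto simp: comb algebra_simps)
  thus "?s \<rho> = f \<bullet> v" using \<sigma> \<tau> v by (simp add: dual_space_iff)
qed (rule \<rho>)

lemma dual_space_closed:
  assumes X: "\<And>n. X n \<in> \<Sigma>" and x: "x \<in> carrier_vec M"
    and lim: "\<And>i. i < M \<Longrightarrow> (\<lambda>n. X n $ i) \<longlonglongrightarrow> x $ i"
  shows "x \<in> \<Sigma>"
  unfolding dual_space_iff
proof (intro conjI ballI)
  fix v assume v: "v \<in> mat_kernel A"
  have "(\<lambda>n. \<Sum>\<alpha><M. X n $ \<alpha> * (B *\<^sub>v v) $ \<alpha>) \<longlonglongrightarrow> (\<Sum>\<alpha><M. x $ \<alpha> * (B *\<^sub>v v) $ \<alpha>)"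
    by (intro tendsto_intros lim) auto
  moreover have "(\<Sum>\<alpha><M. X n $ \<alpha> * (B *\<^sub>v v) $ \<alpha>) = f \<bullet> v" for n
    using X[of n] v by (simp add: dual_space_iff)
  ultimately show "(\<Sum>\<alpha><M. x $ \<alpha> * (B *\<^sub>v v) $ \<alpha>) = f \<bullet> v"
    by (simp add: LIMSEQ_const_iff)
qed (rule x)

section \<open>The least-squares step and the minimizer\<close>

lemma solution_unique: "\<exists>!u. dirls_solution \<phi>' w B A f g \<sigma> u"
  using weighted_least_squares_unique_solution[OF B A f g ker, of "irls_weight \<sigma>"] coeff_pos w_pos B
  unfolding dirls_solution_def by simp

text \<open>The weighted equation solved by \<open>u\<close> is literally the membership condition
  for the new iterate, so a step lands in the dual space from any starting vector.\<close>

lemma step_obtain: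
  obtains u where "u \<in> mat_kernel A" "u \<in> carrier_vec N"
    "step \<sigma> = vec M (\<lambda>\<alpha>. irls_weight \<sigma> \<alpha> * (B *\<^sub>v (u + g)) $ \<alpha>)" "step \<sigma> \<in> \<Sigma>"
proof -
  define u where "u = (THE u. dirls_solution \<phi>' w B A f g \<sigma> u)"
  have sol: "dirls_solution \<phi>' w B A f g \<sigma> u"
    unfolding u_def by (rule theI'[OF solution_unique])
  have eq: "step \<sigma> = vec M (\<lambda>\<alpha>. irls_weight \<sigma> \<alpha> * (B *\<^sub>v (u + g)) $ \<alpha>)"
    using B by (simp add: dirls_step_def u_def)
  moreover have "u \<in> mat_kernel A" using sol by (simp add: dirls_solution_def)
  moreover have "u \<in> carrier_vec N" using calculation mat_kernelD[OF A] by blast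
  moreover have "step \<sigma> \<in> \<Sigma>"
    using sol B unfolding eq dual_space_iff dirls_solution_def by simp
  ultimately show thesis using that by blast
qed

text \<open>\<open>energy_density_ge\<close> summed over the components; the first factor is the
  gradient of \<open>J\<close> at \<open>\<sigma>\<close>.\<close>

lemma energy_ge_quadratic:
  assumes "\<sigma> \<in> carrier_vec M" "\<tau> \<in> carrier_vec M"
  shows "J \<sigma> + (\<Sum>\<alpha><M. (\<sigma> $ \<alpha> / irls_weight \<sigma> \<alpha> - (B *\<^sub>v g) $ \<alpha>) * (\<tau> $ \<alpha> - \<sigma> $ \<alpha>)
      + (\<tau> $ \<alpha> - \<sigma> $ \<alpha>)\<^sup>2 / (2 * L * w $ \<alpha>)) \<le> J \<tau>"
  unfolding energy_eq[OF assms(1)] energy_eq[OF assms(2)] sum.distrib[symmetric]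
proof (rule sum_mono)
  fix \<alpha> assume "\<alpha> \<in> {..<M}"
  hence "0 < w $ \<alpha>" using w_pos by simp
  from energy_density_ge[OF this, of "\<sigma> $ \<alpha>" "\<tau> $ \<alpha>"]
  show "w $ \<alpha> * \<psi> (inverse (w $ \<alpha>) * \<bar>\<sigma> $ \<alpha>\<bar>) - \<sigma> $ \<alpha> * (B *\<^sub>v g) $ \<alpha> +
      ((\<sigma> $ \<alpha> / irls_weight \<sigma> \<alpha> - (B *\<^sub>v g) $ \<alpha>) * (\<tau> $ \<alpha> - \<sigma> $ \<alpha>) + (\<tau> $ \<alpha> - \<sigma> $ \<alpha>)\<^sup>2 / (2 * L * w $ \<alpha>))
    \<le> w $ \<alpha> * \<psi> (inverse (w $ \<alpha>) * \<bar>\<tau> $ \<alpha>\<bar>) - \<tau> $ \<alpha> * (B *\<^sub>v g) $ \<alpha>"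
    by (simp add: left_diff_distrib right_diff_distrib mult.commute)
qed

lemma minimizer_unique:
  assumes "\<Sigma> \<noteq> {}"
  shows "\<exists>!\<sigma>. dual_minimizer \<phi> w B A f g \<sigma>"
  unfolding dual_minimizer_def
proof (rule strongly_convex_unique_minimizer[OF dual_space_carrier assms])
  \<comment> \<open>A common upper bound of the weights gives one modulus for all components; the
    summand 1 keeps it positive even for \<open>M = 0\<close>.\<close>
  define W where "W = 1 + (\<Sum>\<alpha><M. w $ \<alpha>)"
  have w_le: "w $ \<alpha> \<le> W" if "\<alpha> < M" for \<alpha>
    using member_le_sum[of \<alpha> "{..<M}" "($) w"] that w_pos by (auto simp: W_def less_imp_le)
  have "0 \<le> (\<Sum>\<alpha><M. w $ \<alpha>)" using w_pos by (intro sum_nonneg) (auto simp: less_imp_le)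
  hence W: "0 < W" by (simp add: W_def)
  show "0 < 1 / (2 * L * W)" using L_pos W by simp
  fix x y assume x: "x \<in> \<Sigma>" and y: "y \<in> \<Sigma>"
  hence c: "x \<in> carrier_vec M" "y \<in> carrier_vec M" by (auto simp: dual_space_iff)
  show "(1 / 2) \<cdot>\<^sub>v (x + y) \<in> \<Sigma>"
    using c by (intro dual_space_affine[OF x y, of _ "1 / 2"]) (auto simp: field_simps)
  have "(\<Sum>i<M. (x $ i / irls_weight x i - (B *\<^sub>v g) $ i) * (y $ i - x $ i)) +
      1 / (2 * L * W) * (\<Sum>i<M. (y $ i - x $ i)\<^sup>2) \<le>
      (\<Sum>i<M. (x $ i / irls_weight x i - (B *\<^sub>v g) $ i) * (y $ i - x $ i)
        + (y $ i - x $ i)\<^sup>2 / (2 * L * w $ i))"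
    unfolding sum_distrib_left sum.distrib[symmetric]
  proof (intro sum_mono add_left_mono)
    fix i assume "i \<in> {..<M}"
    hence "0 < 2 * L * w $ i" "2 * L * w $ i \<le> 2 * L * W" using w_pos w_le L_pos by auto
    thus "1 / (2 * L * W) * (y $ i - x $ i)\<^sup>2 \<le> (y $ i - x $ i)\<^sup>2 / (2 * L * w $ i)"
      using frac_le[of "(y $ i - x $ i)\<^sup>2" "(y $ i - x $ i)\<^sup>2" "2 * L * w $ i" "2 * L * W"] by simp
  qed
  thus "J x + (\<Sum>i<M. (x $ i / irls_weight x i - (B *\<^sub>v g) $ i) * (y $ i - x $ i)) +
      1 / (2 * L * W) * (\<Sum>i<M. (y $ i - x $ i)\<^sup>2) \<le> J y"
    using energy_ge_quadratic[OF c] by linarith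
qed (rule dual_space_closed)

text \<open>The right-hand side is the quadratic majorant of \<open>J\<close> at
  \<open>\<sigma>\<close>, evaluated at \<open>\<tau>\<close>. Its gradient at the new iterate is
  \<open>B *\<^sub>v u\<close>, which is orthogonal to differences of feasible vectors, so the
  iterate minimizes it over the dual space.\<close>

lemma energy_step_le:
  assumes \<sigma>: "\<sigma> \<in> carrier_vec M" and \<tau>: "\<tau> \<in> \<Sigma>"
  shows "J (step \<sigma>) \<le> J \<sigma> + (\<Sum>\<alpha><M. ((\<tau> $ \<alpha>)\<^sup>2 - (\<sigma> $ \<alpha>)\<^sup>2) / (2 * irls_weight \<sigma> \<alpha>)
      - (\<tau> $ \<alpha> - \<sigma> $ \<alpha>) * (B *\<^sub>v g) $ \<alpha>)"
proof -
  obtain u where u: "u \<in> mat_kernel A" "u \<in> carrier_vec N"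
    and eq: "step \<sigma> = vec M (\<lambda>\<alpha>. irls_weight \<sigma> \<alpha> * (B *\<^sub>v (u + g)) $ \<alpha>)" and mem: "step \<sigma> \<in> \<Sigma>"
    by (rule step_obtain)
  define s where "s = step \<sigma>"
  have s: "s \<in> \<Sigma>" "s \<in> carrier_vec M" using mem by (auto simp: s_def dual_space_iff)
  have orth: "(\<Sum>\<alpha><M. (\<tau> $ \<alpha> - s $ \<alpha>) * (B *\<^sub>v u) $ \<alpha>) = 0"
    using s \<tau> u by (simp add: dual_space_iff left_diff_distrib sum_subtractf)
  \<comment> \<open>The orthogonal term, whose sum is zero, is subtracted so that the inequality
    holds in every component and not only in total.\<close>
  have "J s \<le> J \<sigma> + (\<Sum>\<alpha><M. ((\<tau> $ \<alpha>)\<^sup>2 - (\<sigma> $ \<alpha>)\<^sup>2) / (2 * irls_weight \<sigma> \<alpha>)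
      - (\<tau> $ \<alpha> - \<sigma> $ \<alpha>) * (B *\<^sub>v g) $ \<alpha> - (\<tau> $ \<alpha> - s $ \<alpha>) * (B *\<^sub>v u) $ \<alpha>)"
    unfolding energy_eq[OF \<sigma>] energy_eq[OF s(2)] sum.distrib[symmetric]
  proof (rule sum_mono)
    fix \<alpha> assume "\<alpha> \<in> {..<M}"
    hence \<alpha>: "\<alpha> < M" and w: "0 < w $ \<alpha>" using w_pos by auto
    define a where "a = irls_weight \<sigma> \<alpha>"
    have a: "0 < a" using coeff_pos[OF w] by (simp add: a_def)
    have s\<alpha>: "s $ \<alpha> = a * ((B *\<^sub>v u) $ \<alpha> + (B *\<^sub>v g) $ \<alpha>)"
      using eq \<alpha> B u g by (simp add: s_def a_def mult_add_distrib_mat_vec[OF B])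
    have "((\<tau> $ \<alpha>)\<^sup>2 - (s $ \<alpha>)\<^sup>2) / (2 * a) -
        (\<tau> $ \<alpha> - s $ \<alpha>) * ((B *\<^sub>v u) $ \<alpha> + (B *\<^sub>v g) $ \<alpha>) = (\<tau> $ \<alpha> - s $ \<alpha>)\<^sup>2 / (2 * a)"
      unfolding s\<alpha> using a by (simp add: field_simps power2_eq_square)
    moreover have "0 \<le> (\<tau> $ \<alpha> - s $ \<alpha>)\<^sup>2 / (2 * a)" using a by simp
    moreover note energy_density_le[OF w, of "s $ \<alpha>" "\<sigma> $ \<alpha>", folded a_def]
    ultimately show "w $ \<alpha> * \<psi> (inverse (w $ \<alpha>) * \<bar>s $ \<alpha>\<bar>) - s $ \<alpha> * (B *\<^sub>v g) $ \<alpha> \<le>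
      w $ \<alpha> * \<psi> (inverse (w $ \<alpha>) * \<bar>\<sigma> $ \<alpha>\<bar>) - \<sigma> $ \<alpha> * (B *\<^sub>v g) $ \<alpha> +
      (((\<tau> $ \<alpha>)\<^sup>2 - (\<sigma> $ \<alpha>)\<^sup>2) / (2 * irls_weight \<sigma> \<alpha>) -
        (\<tau> $ \<alpha> - \<sigma> $ \<alpha>) * (B *\<^sub>v g) $ \<alpha> - (\<tau> $ \<alpha> - s $ \<alpha>) * (B *\<^sub>v u) $ \<alpha>)"
      unfolding a_def[symmetric] by (simp add: diff_divide_distrib algebra_simps)
  qed
  thus ?thesis using orth unfolding s_def by (simp add: sum_subtractf)
qed

lemma energy_decay:
  assumes \<sigma>: "\<sigma> \<in> \<Sigma>" and \<tau>: "\<tau> \<in> \<Sigma>"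
  shows "J (step \<sigma>) - J \<tau> \<le> (1 - c / L) * (J \<sigma> - J \<tau>)"
proof -
  define \<mu> where "\<mu> = c / L"
  have \<mu>: "0 < \<mu>" using c_pos L_pos by (simp add: \<mu>_def)
  have carrier: "\<sigma> \<in> carrier_vec M" "\<tau> \<in> carrier_vec M" using \<sigma> \<tau> by (auto simp: dual_space_iff)
  define \<rho> where "\<rho> = vec M (\<lambda>\<alpha>. \<sigma> $ \<alpha> + \<mu> * (\<tau> $ \<alpha> - \<sigma> $ \<alpha>))"
  have \<rho>: "\<rho> \<in> \<Sigma>"
    by (rule dual_space_affine[OF \<sigma> \<tau>, of _ \<mu>]) (auto simp: \<rho>_def)
  have "(\<Sum>\<alpha><M. ((\<rho> $ \<alpha>)\<^sup>2 - (\<sigma> $ \<alpha>)\<^sup>2) / (2 * irls_weight \<sigma> \<alpha>) - (\<rho> $ \<alpha> - \<sigma> $ \<alpha>) * (B *\<^sub>v g) $ \<alpha>) \<le>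
    \<mu> * (\<Sum>\<alpha><M. (\<sigma> $ \<alpha> / irls_weight \<sigma> \<alpha> - (B *\<^sub>v g) $ \<alpha>) * (\<tau> $ \<alpha> - \<sigma> $ \<alpha>)
      + (\<tau> $ \<alpha> - \<sigma> $ \<alpha>)\<^sup>2 / (2 * L * w $ \<alpha>))"
    unfolding sum_distrib_left
  proof (rule sum_mono)
    fix \<alpha> assume "\<alpha> \<in> {..<M}"
    hence \<alpha>: "\<alpha> < M" and w: "0 < w $ \<alpha>" using w_pos by auto
    define a d where "a = irls_weight \<sigma> \<alpha>" and "d = \<tau> $ \<alpha> - \<sigma> $ \<alpha>"
    have a: "0 < a" "c * w $ \<alpha> \<le> a" using coeff_pos[OF w] coeff_ge[OF w] by (auto simp: a_def)
    \<comment> \<open>This fixes the size of \<open>\<mu>\<close>. The quadratic term carries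
      \<open>\<mu>\<close> twice; one factor is absorbed in passing from \<open>1 / a\<close> to the
      modulus \<open>1 / (L * w $ \<alpha>)\<close>, and the other multiplies the whole strong
      convexity bound.\<close>
    have "\<mu> / a \<le> 1 / (L * w $ \<alpha>)"
      using a w L_pos by (simp add: \<mu>_def field_simps)
    hence "\<mu> * d\<^sup>2 / 2 * (\<mu> / a) \<le> \<mu> * d\<^sup>2 / 2 * (1 / (L * w $ \<alpha>))"
      using \<mu> by (intro mult_left_mono) auto
    moreover have \<rho>\<alpha>: "\<rho> $ \<alpha> = \<sigma> $ \<alpha> + \<mu> * d" using \<alpha> by (simp add: \<rho>_def d_def)
    moreover have "((\<rho> $ \<alpha>)\<^sup>2 - (\<sigma> $ \<alpha>)\<^sup>2) / (2 * a) = \<mu> * (\<sigma> $ \<alpha> / a * d) + \<mu> * d\<^sup>2 / 2 * (\<mu> / a)"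
      unfolding \<rho>\<alpha> using a by (simp add: field_simps power2_eq_square)
    moreover have "\<rho> $ \<alpha> - \<sigma> $ \<alpha> = \<mu> * d" by (simp add: \<rho>\<alpha>)
    ultimately show "((\<rho> $ \<alpha>)\<^sup>2 - (\<sigma> $ \<alpha>)\<^sup>2) / (2 * irls_weight \<sigma> \<alpha>) - (\<rho> $ \<alpha> - \<sigma> $ \<alpha>) * (B *\<^sub>v g) $ \<alpha> \<le>
      \<mu> * ((\<sigma> $ \<alpha> / irls_weight \<sigma> \<alpha> - (B *\<^sub>v g) $ \<alpha>) * (\<tau> $ \<alpha> - \<sigma> $ \<alpha>)
        + (\<tau> $ \<alpha> - \<sigma> $ \<alpha>)\<^sup>2 / (2 * L * w $ \<alpha>))"
      unfolding a_def[symmetric] d_def[symmetric] by (simp add: algebra_simps)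
  qed
  also have "\<dots> \<le> \<mu> * (J \<tau> - J \<sigma>)"
    using energy_ge_quadratic[OF carrier] \<mu> by (intro mult_left_mono) auto
  finally have "J (step \<sigma>) \<le> J \<sigma> + \<mu> * (J \<tau> - J \<sigma>)"
    using energy_step_le[OF carrier(1) \<rho>] by linarith
  thus ?thesis by (simp add: \<mu>_def[symmetric] algebra_simps)
qed

lemma dirls_in_dual_space:
  assumes "\<sigma>0 \<in> \<Sigma>"
  shows "dirls \<phi>' w B A f g \<sigma>0 n \<in> \<Sigma>"
proof (induction n)
  case (Suc n)
  show ?case by (simp add: dirls_def) (rule step_obtain)
qed (use assms in \<open>simp add: dirls_def\<close>)

lemma dirls_linear_convergence:
  assumes \<sigma>0: "\<sigma>0 \<in> \<Sigma>" and \<tau>: "\<tau> \<in> \<Sigma>"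
  shows "J (dirls \<phi>' w B A f g \<sigma>0 n) - J \<tau> \<le> (1 - c / L) ^ n * (J \<sigma>0 - J \<tau>)"
proof (induction n)
  case (Suc n)
  \<comment> \<open>A nonnegative factor is required to multiply the induction hypothesis by
    it.\<close>
  have "c \<le> L" using ratio_ge[of 1] ratio_le[of 1] C_le_L by simp
  hence rate: "0 \<le> 1 - c / L" using L_pos by simp
  have "J (dirls \<phi>' w B A f g \<sigma>0 (Suc n)) - J \<tau> \<le> (1 - c / L) * (J (dirls \<phi>' w B A f g \<sigma>0 n) - J \<tau>)"
    using energy_decay[OF dirls_in_dual_space[OF \<sigma>0] \<tau>, of n] by (simp add: dirls_def)
  also have "\<dots> \<le> (1 - c / L) * ((1 - c / L) ^ n * (J \<sigma>0 - J \<tau>))"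
    by (rule mult_left_mono[OF Suc.IH rate])
  finally show ?case by (simp add: mult.assoc)
qed (simp add: dirls_def)

end

theorem theorem3p6:
  fixes k1 k2 :: real
  shows "\<exists>C_uc>0. \<forall>(\<phi> :: real \<Rightarrow> real) (\<phi>' :: real \<Rightarrow> real) (c_phi :: real) (C_phi :: real)
      (M :: nat) (N :: nat) (m_c :: nat) (B :: real mat) (C :: real mat)
      (w :: real vec) (f :: real vec) (g :: real vec) (d :: real vec) (\<sigma>0 :: real vec).
    N_function \<phi> \<phi>' \<and> uniformly_convex_with k1 k2 \<phi>' \<and>
    (\<forall>t T. 0 < t \<and> t \<le> T \<longrightarrow> \<phi>' t / t \<le> \<phi>' T / T) \<and>
    ((\<lambda>t. \<phi>' t / t) \<longlongrightarrow> c_phi) (at_right 0) \<and> ((\<lambda>T. \<phi>' T / T) \<longlongrightarrow> C_phi) at_top \<and>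
    0 < c_phi \<and> c_phi \<le> C_phi \<and>
    1 \<le> M \<and> 1 \<le> N \<and> B \<in> carrier_mat M N \<and>
    w \<in> carrier_vec M \<and> (\<forall>\<alpha><M. 0 < w $ \<alpha>) \<and>
    f \<in> carrier_vec N \<and> C \<in> carrier_mat m_c N \<and> d \<in> carrier_vec m_c \<and>
    g \<in> carrier_vec N \<and> C *\<^sub>v g = d \<and>
    mat_kernel B \<inter> mat_kernel C = {0\<^sub>v N} \<and>
    \<sigma>0 \<in> dual_space B C f \<longrightarrow>
      (\<forall>n. (\<forall>\<alpha><M. dirls_coeff_defined \<phi>' (w $ \<alpha>) (dirls \<phi>' w B C f g \<sigma>0 n $ \<alpha>)) \<and>
           (\<exists>!u. dirls_solution \<phi>' w B C f g (dirls \<phi>' w B C f g \<sigma>0 n) u) \<and>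
           dirls \<phi>' w B C f g \<sigma>0 n \<in> dual_space B C f) \<and>
      (\<exists>!\<sigma>. dual_minimizer \<phi> w B C f g \<sigma>) \<and>
      (\<forall>\<sigma>. dual_minimizer \<phi> w B C f g \<sigma> \<longrightarrow>
        (\<forall>n. dual_energy \<phi> w B g (dirls \<phi>' w B C f g \<sigma>0 n) - dual_energy \<phi> w B g \<sigma>
             \<le> (1 - C_uc * (c_phi / C_phi)) ^ n *
                (dual_energy \<phi> w B g \<sigma>0 - dual_energy \<phi> w B g \<sigma>)))"
\<comment> \<open>The witness must be positive for arbitrary \<open>k1\<close> and
  \<open>k2\<close>. If \<open>k2\<close> is not positive, no function is uniformly convex with
  these constants and the value 1 is a dummy; otherwise \<open>1 / k2\<close> turns the rate into
  \<open>c_phi / L\<close>.\<close>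
proof (rule exI[of _ "if 0 < k2 then 1 / k2 else 1"], intro conjI allI impI, goal_cases)
  case 1
  show ?case by simp
next
  case prems: (2 \<phi> \<phi>' c_phi C_phi M N m_c B C w f g d \<sigma>0 n \<alpha>)
  then interpret dual_problem \<phi> \<phi>' k1 k2 c_phi C_phi M N m_c B C w f g
    by unfold_locales auto
  show ?case using coeff_defined w_pos prems by blast
next
  case prems: (3 \<phi> \<phi>' c_phi C_phi M N m_c B C w f g d \<sigma>0 n)
  then interpret dual_problem \<phi> \<phi>' k1 k2 c_phi C_phi M N m_c B C w f g
    by unfold_locales auto
  show ?case by (rule solution_unique)
next
  case prems: (4 \<phi> \<phi>' c_phi C_phi M N m_c B C w f g d \<sigma>0 n)
  then interpret dual_problem \<phi> \<phi>' k1 k2 c_phi C_phi M N m_c B C w f g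
    by unfold_locales auto
  show ?case by (rule dirls_in_dual_space) (use prems in blast)
next
  case prems: (5 \<phi> \<phi>' c_phi C_phi M N m_c B C w f g d \<sigma>0)
  then interpret dual_problem \<phi> \<phi>' k1 k2 c_phi C_phi M N m_c B C w f g
    by unfold_locales auto
  show ?case by (rule minimizer_unique) (use prems in blast)
next
  case prems: (6 \<phi> \<phi>' c_phi C_phi M N m_c B C w f g d \<sigma>0 \<sigma> n)
  then interpret dual_problem \<phi> \<phi>' k1 k2 c_phi C_phi M N m_c B C w f g
    by unfold_locales auto
  have "(if 0 < k2 then 1 / k2 else 1) * (c_phi / C_phi) = c_phi / L"
    using k2_ge_1 by (simp add: L_def)
  thus ?case
    using dirls_linear_convergence[of \<sigma>0 \<sigma> n] prems by (simp add: dual_minimizer_def)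
qed

end
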